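(* Let $G$ be a graph with the canonical labeling and trivial multiplicity (the classical case), $E_G=\{e_1,\dots,e_m\}$, let $A=\{a_1,\dots,a_k\}$, let $\sigma$ be a multiplicity map of $G$ and $l:E_G\to A$ a labeling of $G$. Then: i) Permuting the names of the vertices of $G$ corresponds to a permutation of the columns of the matrix $\mathcal{A}_G$. ii) There exists a unique matrix $M_\sigma$ such that $\mathcal{A}_{(G,\sigma)}=M_\sigma\mathcal{A}_G$. It is the block matrix $M_\sigma=\begin{pmatrix}I_\sigma&0\\0&I_\sigma\end{pmatrix}$ with $I_\sigma=\operatorname{diag}(\sigma(e_1),\dots,\sigma(e_m))$. iii) There exists a unique matrix $R_l$ such that $\mathcal{A}_{(G,l,A)}=R_l\mathcal{A}_G$. It is a $2|A|\times2|E_G|$ matrix of the block form $R_l=\begin{pmatrix}B_l&0\\0&B_l\end{pmatrix}$, where $B_l=(b_{i,j})$ is the $|A|\times|E_G|$ matrix with $b_{i,j}=\delta_{a_i,l(e_j)}$. Now let $G=(G,l,A,\sigma)$, with $A=\{a_1,\dots,a_k\}$, and $H$ be labelled graphs with multiplicity. iii.bis) Let $l'$ be a labeling constructed from $l$ by assigning to all the elements of $l^{-1}(a_k)$ one and the same element of $C=A\setminus\{a_k\}$ (and leaving all other labels unchanged). Then there exists a unique matrix $R_{l'}$ such that $\mathcal{A}_{(G,l',C,\sigma)}=R_{l'}\mathcal{A}_{(G,l,A,\sigma)}$. It is a $2|C|\times2|A|$ matrix of the block form $R_{l'}=\begin{pmatrix}B_{l'}&0\\0&B_{l'}\end{pmatrix}$,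 where $B_{l'}=(b_{i,j})$ is the $|C|\times|A|$ matrix with $b_{i,j}=\delta_{a_i,l'(a_j)}$; here $l'(a_j)$ denotes the new label in $C$ of the edges with $l$-label $a_j$. iv) $\mathcal{A}_{G\sqcup H}$ is made of the columns of $\mathcal{A}_G\#\mathcal{A}_H$, each repeated twice. v) $\mathcal{A}_{G\#_0H}=\mathcal{A}_G\#\mathcal{A}_H$.
   Context: Graphs are finite and simple with nonempty vertex set, $G=(V_G;E_G)$. Partitions. For a finite nonempty set $V$, $\Pi_V$ is the set of unordered pairs $A|B$ with $A\cup B=V$, $A\cap B=\emptyset$ (one of $A,B$ may be empty; $A|B=B|A$). $Cut_G(A|B)$ is the set of edges of $G$ with one endpoint in $A$ and the other in $B$. Labelled graphs with multiplicity. A labeling is a surjective map $l:E_G\to A$ onto a set $A$ of labels; the canonical labeling is $\{i,j\}\mapsto(i,j)$ (a bijection, so the label set is identified with $E_G$). A multiplicity map is a map $\sigma:E_G\to\mathbb{Z}\setminus\{0\}$; it is trivial if $\sigma\equiv1$. Then $(G,l,A,\sigma)$ is a labelled graph with multiplicity. When omitted, the labeling is canonical and the multiplicity trivial: $(G,\sigma)$ has canonical labeling and multiplicity $\sigma$; $(G,l,A)$ has labeling $l$ and trivial multiplicity. The matrix $\mathcal{A}$. The toric map $\phi_{(G,l,A,\sigma)}$ sends the variable $r_p$ ($p\in\Pi_{V_G}$) to the Laurent monomial $\prod_{e\in Cut_G(p)}s_{l(e)}^{\sigma(e)}\prod_{e\in E_G\setminus Cut_G(p)}t_{l(e)}^{\sigma(e)}$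 in variables $s_a,t_a$ ($a\in A$). $\mathcal{A}_{(G,l,A,\sigma)}$ is the integer matrix with $2|A|$ rows (indexed first by $s_a$, $a\in A$, then by $t_a$, $a\in A$, in a fixed order of $A$) and columns indexed by $\Pi_{V_G}$, the column of $p$ being the exponent vector of the image of $r_p$. In i), the edges of the graph with renamed vertices are matched with (and ordered as) the corresponding edges of $G$. Operations. The disjoint union is $(G,l,A,\sigma)\sqcup(H,i,B,\rho)=(G\sqcup H,(l,i),A\sqcup B,(\sigma,\rho))$, with disjoint label sets. The clique $0$-sum $G\#_0H$ is the labelled graph with multiplicity obtained from $G\sqcup H$ by identifying one vertex of $G$ with one vertex of $H$ (any choice), edges keeping their labels (in $A\sqcup B$) and multiplicities. The matrix $\mathcal{A}_G\#\mathcal{A}_H$ has rows indexed by the rows of $\mathcal{A}_G$ together with the rows of $\mathcal{A}_H$, and its columns are obtained by combining (stacking) a column of $\mathcal{A}_G$ with a column of $\mathcal{A}_H$ in all possible ways, one column for each pair in $\Pi_{V_G}\times\Pi_{V_H}$. The statements iv) and v) are understood up to the ordering of rows and columns.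
   Formalization: In ii), iii) and iii.bis) uniqueness is asserted only among block-diagonal matrices diag(X,Y) of the displayed shape; among all matrices it fails once there are two edges (or labels), since the row sums s_e+t_e are all the same constant row, so the rows are dependent. *)

theory Defs
  imports "Jordan_Normal_Form.Matrix" "HOL-Library.Poly_Mapping"
    "HOL-Combinatorics.Permutations"
begin

definition simple_graph :: "'v set \<Rightarrow> 'v set set \<Rightarrow> bool" where
  "simple_graph V E \<longleftrightarrow>
     finite V \<and> V \<noteq> {} \<and> (\<forall>e\<in>E. \<exists>x\<in>V. \<exists>y\<in>V. x \<noteq> y \<and> e = {x, y})"

definition is_labeling :: "'v set set \<Rightarrow> ('v set \<Rightarrow> 'a) \<Rightarrow> 'a set \<Rightarrow> bool" where
  "is_labeling E l A \<longleftrightarrow> l ` E = A"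

definition is_multiplicity :: "'v set set \<Rightarrow> ('v set \<Rightarrow> int) \<Rightarrow> bool" where
  "is_multiplicity E \<sigma> \<longleftrightarrow> (\<forall>e\<in>E. \<sigma> e \<noteq> 0)"

record ('v, 'a) lgraph =
  verts :: "'v set"
  edges :: "'v set set"
  lab :: "'v set \<Rightarrow> 'a"
  labels :: "'a set"
  mult :: "'v set \<Rightarrow> int"

definition labelled_graph :: "('v, 'a) lgraph \<Rightarrow> bool" where
  "labelled_graph G \<longleftrightarrow> simple_graph (verts G) (edges G) \<and>
     is_labeling (edges G) (lab G) (labels G) \<and> is_multiplicity (edges G) (mult G)"

text \<open>For the canonical labeling the label set is identified with the edge set.\<close>

definition with_mult :: "'v set \<Rightarrow> 'v set set \<Rightarrow> ('v set \<Rightarrow> int) \<Rightarrow> ('v, 'v set) lgraph" where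
  "with_mult V E \<sigma> = \<lparr>verts = V, edges = E, lab = (\<lambda>e. e), labels = E, mult = \<sigma>\<rparr>"

definition with_lab :: "'v set \<Rightarrow> 'v set set \<Rightarrow> ('v set \<Rightarrow> 'a) \<Rightarrow> 'a set \<Rightarrow> ('v, 'a) lgraph" where
  "with_lab V E l A = \<lparr>verts = V, edges = E, lab = l, labels = A, mult = (\<lambda>_. 1)\<rparr>"

definition classical :: "'v set \<Rightarrow> 'v set set \<Rightarrow> ('v, 'v set) lgraph" where
  "classical V E = \<lparr>verts = V, edges = E, lab = (\<lambda>e. e), labels = E, mult = (\<lambda>_. 1)\<rparr>"

text \<open>The unordered pair \<open>A|B\<close> is the set \<open>{A, B}\<close>.\<close>

definition partitions :: "'v set \<Rightarrow> 'v set set set" where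
  "partitions V = {{A, B} |A B. A \<union> B = V \<and> A \<inter> B = {}}"

definition cut :: "('v, 'a) lgraph \<Rightarrow> 'v set set \<Rightarrow> 'v set set" where
  "cut G p = {e \<in> edges G. \<exists>A B x y. p = {A, B} \<and> x \<in> A \<and> y \<in> B \<and> e = {x, y}}"

text \<open>A Laurent monomial in the variables \<open>s\<^sub>a\<close>, \<open>t\<^sub>a\<close> is represented by its exponent
  function, so products of monomials are written as sums.\<close>

datatype 'a tvar = S_var 'a | T_var 'a

definition toric_monomial :: "('v, 'a) lgraph \<Rightarrow> 'v set set \<Rightarrow> 'a tvar \<Rightarrow>\<^sub>0 int" where
  "toric_monomial G p =
     (\<Sum>e\<in>cut G p. Poly_Mapping.single (S_var (lab G e)) (mult G e)) +
     (\<Sum>e\<in>edges G - cut G p. Poly_Mapping.single (T_var (lab G e)) (mult G e))"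

definition enumerates :: "'x list \<Rightarrow> 'x set \<Rightarrow> bool" where
  "enumerates xs X \<longleftrightarrow> distinct xs \<and> set xs = X"

definition row_vars :: "'a list \<Rightarrow> 'a tvar list" where
  "row_vars as = map S_var as @ map T_var as"

text \<open>The lists \<open>as\<close> and \<open>ps\<close> fix the order of the labels and of the partitions.\<close>

definition toric_mat :: "('v, 'a) lgraph \<Rightarrow> 'a list \<Rightarrow> 'v set set list \<Rightarrow> int mat" where
  "toric_mat G as ps = mat (2 * length as) (length ps)
     (\<lambda>(i, j). Poly_Mapping.lookup (toric_monomial G (ps ! j)) (row_vars as ! i))"

definition block_diag :: "'c::zero mat \<Rightarrow> 'c mat \<Rightarrow> 'c mat" where
  "block_diag X Y = four_block_mat X (0\<^sub>m (dim_row X) (dim_col Y)) (0\<^sub>m (dim_row Y) (dim_col X)) Y"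

text \<open>Uniqueness of the left factors is meant among matrices of this form (the two diagonal
  blocks need not be equal). It fails for arbitrary matrices: the sum of the rows of \<open>s\<^sub>e\<close>
  and \<open>t\<^sub>e\<close> is the all-ones row for every edge \<open>e\<close> of a classical graph, so the rows are
  linearly dependent as soon as there are two edges.\<close>

definition has_block_form :: "nat \<Rightarrow> nat \<Rightarrow> 'c::zero mat \<Rightarrow> bool" where
  "has_block_form r c M \<longleftrightarrow>
     (\<exists>X \<in> carrier_mat r c. \<exists>Y \<in> carrier_mat r c. M = block_diag X Y)"

definition disj_union ::
    "('v, 'a) lgraph \<Rightarrow> ('w, 'b) lgraph \<Rightarrow> ('v + 'w, 'a + 'b) lgraph" where
  "disj_union G H = \<lparr>
     verts = verts G <+> verts H,
     edges = (`) Inl ` edges G \<union> (`) Inr ` edges H,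
     lab = (\<lambda>e. if e \<in> (`) Inl ` edges G then Inl (lab G (Inl -` e)) else Inr (lab H (Inr -` e))),
     labels = labels G <+> labels H,
     mult = (\<lambda>e. if e \<in> (`) Inl ` edges G then mult G (Inl -` e) else mult H (Inr -` e))\<rparr>"

text \<open>Only used when \<open>f\<close> does not identify two edges.\<close>

definition map_verts :: "('v \<Rightarrow> 'w) \<Rightarrow> ('v, 'a) lgraph \<Rightarrow> ('w, 'a) lgraph" where
  "map_verts f G = \<lparr>
     verts = f ` verts G,
     edges = (`) f ` edges G,
     lab = (\<lambda>e. lab G (inv_into (edges G) ((`) f) e)),
     labels = labels G,
     mult = (\<lambda>e. mult G (inv_into (edges G) ((`) f) e))\<rparr>"

definition zero_sum ::
    "'v \<Rightarrow> 'w \<Rightarrow> ('v, 'a) lgraph \<Rightarrow> ('w, 'b) lgraph \<Rightarrow> ('v + 'w, 'a + 'b) lgraph" where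
  "zero_sum u v G H = map_verts (\<lambda>z. if z = Inr v then Inl u else z) (disj_union G H)"

definition hash_mat :: "'c mat \<Rightarrow> 'c mat \<Rightarrow> 'c mat" where
  "hash_mat M N = mat_of_cols (dim_row M + dim_row N) [x @\<^sub>v y. x \<leftarrow> cols M, y \<leftarrow> cols N]"

definition hash_row_vars :: "'a list \<Rightarrow> 'b list \<Rightarrow> ('a + 'b) tvar list" where
  "hash_row_vars as bs = map (map_tvar Inl) (row_vars as) @ map (map_tvar Inr) (row_vars bs)"

definition repeat_cols_twice :: "'c mat \<Rightarrow> 'c mat" where
  "repeat_cols_twice M = mat_of_cols (dim_row M) (cols M @ cols M)"

text \<open>Equality up to the order of rows and columns, for matrices whose rows are indexed by
  \<open>xs\<close> and \<open>ys\<close>. The row reordering has to match the row indices, so it is not an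
  arbitrary permutation of the rows.\<close>

definition eq_up_to_order :: "'r list \<Rightarrow> 'c mat \<Rightarrow> 'r list \<Rightarrow> 'c mat \<Rightarrow> bool" where
  "eq_up_to_order xs M ys N \<longleftrightarrow>
     dim_row M = length xs \<and> dim_row N = length ys \<and>
     dim_row M = dim_row N \<and> dim_col M = dim_col N \<and>
     (\<exists>f g. f permutes {..<dim_row M} \<and> g permutes {..<dim_col M} \<and>
        (\<forall>i<dim_row M. xs ! i = ys ! f i) \<and>
        (\<forall>i<dim_row M. \<forall>j<dim_col M. M $$ (i, j) = N $$ (f i, g j)))"

end

theory Submission
  imports Defs
begin

text \<open>
  An edge contributes to the column of \<open>A|B\<close> only through whether it meets both \<open>A\<close> and its
  complement. Fixing a vertex \<open>u\<close>, the partitions of \<open>V\<close> correspond to the subsets of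
  \<open>V - {u}\<close>. With base points \<open>u\<close> of \<open>G\<close> and \<open>w\<close> of \<open>H\<close>, the partitions of \<open>G #\<^sub>0 H\<close> are the
  pairs of subsets of \<open>V\<^sub>G - {u}\<close> and \<open>V\<^sub>H - {w}\<close>, while those of the disjoint union are the pairs
  of subsets of \<open>V\<^sub>G - {u}\<close> and \<open>V\<^sub>H\<close>, where a subset of \<open>V\<^sub>H\<close> and its complement give the same
  column. Hence the columns of the two operations.

  Uniqueness of the left factors: for an edge \<open>e = {x, y}\<close>, the columns of the partitions given by
  \<open>{x}\<close> and \<open>{y}\<close> minus those given by \<open>{x, y}\<close> and \<open>{}\<close> add up to \<open>2 \<sigma>(e)\<close> times the unit vector
  of the label of \<open>e\<close> in the \<open>s\<close>-rows, and to its negative in the \<open>t\<close>-rows.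
\<close>

section \<open>Partitions and exponents\<close>

text \<open>Membership of the edge \<open>e\<close> in the cut of \<open>A | V - A\<close>,
  expressed through one side only. For \<open>e\<close> inside \<open>V\<close> the other side gives
  the same truth value.\<close>

definition crosses :: "'v set \<Rightarrow> 'v set \<Rightarrow> bool" where
  "crosses A e \<longleftrightarrow> e \<inter> A \<noteq> {} \<and> e - A \<noteq> {}"

definition bipartition :: "'v set \<Rightarrow> 'v set \<Rightarrow> 'v set set" where
  "bipartition V A = {A, V - A}"

text \<open>Loops are allowed, so that the property passes to the image under any vertex map, even
  one that identifies the ends of an edge. A loop crosses no set.\<close>

definition pair_edges :: "('v, 'a) lgraph \<Rightarrow> bool" where
  "pair_edges G \<longleftrightarrow> finite (verts G) \<and>
     (\<forall>e\<in>edges G. \<exists>x\<in>verts G. \<exists>y\<in>verts G. e = {x, y})"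

text \<open>The column of \<open>A | V - A\<close> as a function of the row variable, computed from
  the side \<open>A\<close> alone.\<close>

definition expo :: "('v, 'a) lgraph \<Rightarrow> 'v set \<Rightarrow> 'a tvar \<Rightarrow> int" where
  "expo G A x = (\<Sum>e\<in>edges G.
     if x = (if crosses A e then S_var (lab G e) else T_var (lab G e)) then mult G e else 0)"

lemma pair_edges_if_simple_graph:
  "simple_graph (verts G) (edges G) \<Longrightarrow> pair_edges G"
  unfolding simple_graph_def pair_edges_def by meson

lemma pair_edgesE:
  assumes "pair_edges G" "e \<in> edges G"
  obtains x y where "x \<in> verts G" "y \<in> verts G" "e = {x, y}"
  using assms unfolding pair_edges_def by meson

lemma pair_edges_subset: "pair_edges G \<Longrightarrow> e \<in> edges G \<Longrightarrow> e \<subseteq> verts G"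
  by (erule (1) pair_edgesE) simp

lemma pair_edges_finite:
  assumes "pair_edges G" shows "finite (edges G)"
proof (rule finite_subset)
  show "edges G \<subseteq> Pow (verts G)" using pair_edges_subset[OF assms] by blast
  show "finite (Pow (verts G))" using assms by (simp add: pair_edges_def)
qed

lemma partitions_eq_image: "partitions V = bipartition V ` Pow V"
proof
  show "partitions V \<subseteq> bipartition V ` Pow V"
  proof
    fix p assume "p \<in> partitions V"
    then obtain A B where "p = {A, B}" "A \<union> B = V" "A \<inter> B = {}"
      by (auto simp: partitions_def)
    then have "p = bipartition V A" "A \<in> Pow V" by (auto simp: bipartition_def)
    then show "p \<in> bipartition V ` Pow V" by blast
  qed
  show "bipartition V ` Pow V \<subseteq> partitions V"
  proof
    fix p assume "p \<in> bipartition V ` Pow V"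
    then obtain A where "p = {A, V - A}" "A \<union> (V - A) = V" "A \<inter> (V - A) = {}"
      by (auto simp: bipartition_def)
    then show "p \<in> partitions V" unfolding partitions_def by blast
  qed
qed

lemma bipartition_in_partitions: "A \<subseteq> V \<Longrightarrow> bipartition V A \<in> partitions V"
  by (auto simp: partitions_eq_image)

lemma bipartition_complement: "A \<subseteq> V \<Longrightarrow> bipartition V (V - A) = bipartition V A"
  by (simp add: bipartition_def insert_commute double_diff)

text \<open>Exactly one side of a partition avoids the base point \<open>u\<close>; choosing that
  side turns unordered pairs into subsets.\<close>

lemma bij_betw_bipartition_pointed:
  assumes u: "u \<in> V"
  shows "bij_betw (bipartition V) (Pow (V - {u})) (partitions V)"
proof (rule bij_betw_imageI)
  show "inj_on (bipartition V) (Pow (V - {u}))"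
  proof (rule inj_onI)
    fix A B assume A: "A \<in> Pow (V - {u})" and B: "B \<in> Pow (V - {u})" and "bipartition V A = bipartition V B"
    then have "A = B \<or> A = V - B" by (auto simp: bipartition_def doubleton_eq_iff)
    moreover have "u \<notin> A" "u \<in> V - B" using A B u by auto
    ultimately show "A = B" by blast
  qed
  show "bipartition V ` Pow (V - {u}) = partitions V"
  proof
    show "bipartition V ` Pow (V - {u}) \<subseteq> partitions V"
      by (auto simp: partitions_eq_image)
    show "partitions V \<subseteq> bipartition V ` Pow (V - {u})"
    proof
      fix p assume "p \<in> partitions V"
      then obtain A where A: "A \<subseteq> V" "p = bipartition V A" by (auto simp: partitions_eq_image)
      show "p \<in> bipartition V ` Pow (V - {u})"
      proof (cases "u \<in> A")
        case True
        then have "V - A \<in> Pow (V - {u})" by blast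
        then show ?thesis using A bipartition_complement by blast
      qed (use A in auto)
    qed
  qed
qed

lemma crosses_pair: "crosses A {x, y} \<longleftrightarrow> (x \<in> A) \<noteq> (y \<in> A)"
  unfolding crosses_def by auto

lemma crosses_complement: "e \<subseteq> V \<Longrightarrow> crosses (V - A) e = crosses A e"
  unfolding crosses_def by auto

lemma crosses_image: "crosses B (f ` e) = crosses (f -` B) e"
  unfolding crosses_def by auto

section \<open>Cuts and exponent vectors seen from one side of a partition\<close>

lemma in_cut_bipartition_iff:
  assumes G: "pair_edges G" and e: "e \<in> edges G" and A: "A \<subseteq> verts G"
  shows "e \<in> cut G (bipartition (verts G) A) \<longleftrightarrow> crosses A e"
proof -
  obtain x y where xy: "x \<in> verts G" "y \<in> verts G" "e = {x, y}"
    using G e by (rule pair_edgesE)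
  show ?thesis
  proof
    assume "e \<in> cut G (bipartition (verts G) A)"
    then obtain C B v w where "{A, verts G - A} = {C, B}" "v \<in> C" "w \<in> B" "e = {v, w}"
      unfolding cut_def bipartition_def mem_Collect_eq by (elim conjE exE)
    then show "crosses A e" by (auto simp: crosses_def doubleton_eq_iff)
  next
    assume "crosses A e"
    \<comment> \<open>The edge is unordered, so \<open>v\<close> may be taken as its endpoint in
      \<open>A\<close>.\<close>
    then obtain v w where vw: "v \<in> A" "w \<in> verts G - A" "e = {v, w}"
      using xy unfolding xy(3) crosses_pair by (metis DiffI insert_commute)
    show "e \<in> cut G (bipartition (verts G) A)"
      unfolding cut_def bipartition_def mem_Collect_eq
      by (intro conjI e exI[of _ A] exI[of _ "verts G - A"] exI[of _ v] exI[of _ w] refl vw)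
  qed
qed

text \<open>The sums over the cut and over its complement merge into one sum over all edges, because
  each edge contributes to exactly one variable.\<close>

lemma lookup_toric_monomial:
  assumes "finite (edges G)"
  shows "Poly_Mapping.lookup (toric_monomial G p) x = (\<Sum>e\<in>edges G.
     if x = (if e \<in> cut G p then S_var (lab G e) else T_var (lab G e)) then mult G e else 0)"
    (is "_ = sum ?h _")
proof -
  have c: "cut G p \<subseteq> edges G" by (auto simp: cut_def)
  have "sum ?h (edges G) = sum ?h (edges G - cut G p) + sum ?h (cut G p)"
    by (rule sum.subset_diff[OF c assms])
  also have "sum ?h (cut G p)
    = (\<Sum>e\<in>cut G p. Poly_Mapping.lookup (Poly_Mapping.single (S_var (lab G e)) (mult G e)) x)"
    by (rule sum.cong) (auto simp: lookup_single when_def)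
  also have "sum ?h (edges G - cut G p)
    = (\<Sum>e\<in>edges G - cut G p.
        Poly_Mapping.lookup (Poly_Mapping.single (T_var (lab G e)) (mult G e)) x)"
    by (rule sum.cong) (auto simp: lookup_single when_def)
  finally show ?thesis
    by (simp add: toric_monomial_def lookup_add lookup_sum)
qed

lemma lookup_toric_monomial_bipartition:
  assumes G: "pair_edges G" and A: "A \<subseteq> verts G"
  shows "Poly_Mapping.lookup (toric_monomial G (bipartition (verts G) A)) = expo G A"
  unfolding fun_eq_iff lookup_toric_monomial[OF pair_edges_finite[OF G]] expo_def
  by (intro allI sum.cong refl) (simp only: in_cut_bipartition_iff[OF G _ A])

text \<open>An edge crosses a set and its complement alike. This symmetry is the source of the
  repeated columns in iv).\<close>

lemma expo_complement:
  assumes "pair_edges G"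
  shows "expo G (verts G - A) = expo G A"
  unfolding fun_eq_iff expo_def
  by (intro allI sum.cong refl) (simp only: crosses_complement[OF pair_edges_subset[OF assms]])

section \<open>Matrices given by column functions\<close>

text \<open>Columns are kept as functions of the row index, so that matrices with differently
  ordered rows can be compared column by column.\<close>

definition mat_of_funs :: "'r list \<Rightarrow> ('r \<Rightarrow> 'c) list \<Rightarrow> 'c mat" where
  "mat_of_funs xs Fs = mat_of_cols (length xs) (map (\<lambda>\<phi>. vec_of_list (map \<phi> xs)) Fs)"

lemma dim_mat_of_funs [simp]:
  "dim_row (mat_of_funs xs Fs) = length xs" "dim_col (mat_of_funs xs Fs) = length Fs"
  by (simp_all add: mat_of_funs_def)

lemma index_mat_of_funs [simp]:
  "i < length xs \<Longrightarrow> j < length Fs \<Longrightarrow> mat_of_funs xs Fs $$ (i, j) = (Fs ! j) (xs ! i)"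
  by (simp add: mat_of_funs_def mat_of_cols_index vec_of_list_index)

lemma cols_mat_of_funs:
  "cols (mat_of_funs xs Fs) = map (\<lambda>\<phi>. vec_of_list (map \<phi> xs)) Fs"
  unfolding mat_of_funs_def
  by (rule cols_mat_of_cols) (force intro: carrier_vecI)

lemma length_row_vars [simp]: "length (row_vars as) = 2 * length as"
  by (simp add: row_vars_def)

lemma toric_mat_eq_mat_of_funs:
  "toric_mat G as ps =
     mat_of_funs (row_vars as) (map (\<lambda>p. Poly_Mapping.lookup (toric_monomial G p)) ps)"
  by (rule eq_matI) (auto simp: toric_mat_def)

text \<open>Stacking of two columns, described per variable and hence independent of the order in
  which the rows are listed.\<close>

fun join :: "('a tvar \<Rightarrow> 'c) \<Rightarrow> ('b tvar \<Rightarrow> 'c) \<Rightarrow> ('a + 'b) tvar \<Rightarrow> 'c" where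
  "join \<phi> \<psi> (S_var (Inl a)) = \<phi> (S_var a)"
| "join \<phi> \<psi> (T_var (Inl a)) = \<phi> (T_var a)"
| "join \<phi> \<psi> (S_var (Inr b)) = \<psi> (S_var b)"
| "join \<phi> \<psi> (T_var (Inr b)) = \<psi> (T_var b)"

lemma join_map_tvar [simp]:
  "join \<phi> \<psi> (map_tvar Inl x) = \<phi> x" "join \<phi> \<psi> (map_tvar Inr y) = \<psi> y"
  by (cases x; simp) (cases y; simp)

lemma vec_of_list_append_vec: "vec_of_list (xs @ ys) = vec_of_list xs @\<^sub>v vec_of_list ys"
  by (rule eq_vecI) (auto simp: vec_of_list_index nth_append)

lemma hash_mat_of_funs:
  "hash_mat (mat_of_funs xs Fs) (mat_of_funs ys Gs) =
     mat_of_funs (map (map_tvar Inl) xs @ map (map_tvar Inr) ys) [join \<phi> \<psi>. \<phi> \<leftarrow> Fs, \<psi> \<leftarrow> Gs]"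
proof -
  have "[x @\<^sub>v y. x \<leftarrow> cols (mat_of_funs xs Fs), y \<leftarrow> cols (mat_of_funs ys Gs)] =
    map (\<lambda>\<chi>. vec_of_list (map \<chi> (map (map_tvar Inl) xs @ map (map_tvar Inr) ys)))
      [join \<phi> \<psi>. \<phi> \<leftarrow> Fs, \<psi> \<leftarrow> Gs]"
    by (simp add: cols_mat_of_funs map_concat comp_def vec_of_list_append_vec del: vec_of_list_map)
  then show ?thesis by (simp add: hash_mat_def mat_of_funs_def)
qed

lemma repeat_cols_twice_mat_of_funs:
  "repeat_cols_twice (mat_of_funs xs Fs) = mat_of_funs xs (Fs @ Fs)"
  by (simp add: repeat_cols_twice_def cols_mat_of_funs) (simp add: mat_of_funs_def)

section \<open>Reorderings of rows and columns as equalities of multisets\<close>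

lemma nth_permutation_if_mset_eq:
  assumes "mset xs = mset ys"
  obtains f where "f permutes {..<length xs}" "\<And>i. i < length xs \<Longrightarrow> xs ! i = ys ! f i"
proof -
  obtain f where f: "f permutes {..<length ys}" "permute_list f ys = xs"
    using mset_eq_permutation[OF assms] by blast
  have "length xs = length ys" using assms by (rule mset_eq_length)
  then show ?thesis using that f by (auto simp: permute_list_nth)
qed

text \<open>An entry is a column function evaluated at a row index. A permutation matching the row
  indices therefore works for all columns at once, and the two reorderings can be chosen
  separately.\<close>

lemma eq_up_to_order_mat_of_funs:
  assumes "mset xs = mset ys" and "mset Fs = mset Gs"
  shows "eq_up_to_order xs (mat_of_funs xs Fs) ys (mat_of_funs ys Gs)"
proof -
  obtain f where f: "f permutes {..<length xs}" "\<And>i. i < length xs \<Longrightarrow> xs ! i = ys ! f i"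
    using nth_permutation_if_mset_eq[OF assms(1)] by blast
  obtain g where g: "g permutes {..<length Fs}" "\<And>i. i < length Fs \<Longrightarrow> Fs ! i = Gs ! g i"
    using nth_permutation_if_mset_eq[OF assms(2)] by blast
  have len: "length xs = length ys" "length Fs = length Gs"
    using assms by (auto dest: mset_eq_length)
  have fb: "f i < length ys" if "i < length xs" for i
    using permutes_in_image[OF f(1), of i] that len by simp
  have gb: "g i < length Gs" if "i < length Fs" for i
    using permutes_in_image[OF g(1), of i] that len by simp
  show ?thesis
    unfolding eq_up_to_order_def
    by (intro conjI exI[of _ f] exI[of _ g]) (use f g fb gb len in auto)
qed

text \<open>The columns are counted by the sides that avoid \<open>u\<close>. Multisets are needed
  because different partitions may have equal columns, as happens in disconnected graphs.\<close>

lemma mset_toric_columns: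
  assumes G: "pair_edges G" and u: "u \<in> verts G" and ps: "enumerates ps (partitions (verts G))"
  shows "mset (map (\<lambda>p. Poly_Mapping.lookup (toric_monomial G p)) ps) =
    (\<Sum>A\<in>Pow (verts G - {u}). {#expo G A#})"
proof -
  let ?F = "\<lambda>p. Poly_Mapping.lookup (toric_monomial G p)"
  have "mset (map ?F ps) = (\<Sum>p\<in>#mset ps. {#?F p#})"
    by (induction ps) auto
  also have "\<dots> = (\<Sum>p\<in>partitions (verts G). {#?F p#})"
    using ps by (simp add: enumerates_def sum_unfold_sum_mset flip: mset_set_set)
  also have "\<dots> = (\<Sum>A\<in>Pow (verts G - {u}). {#?F (bipartition (verts G) A)#})"
    by (rule sum.reindex_bij_betw[OF bij_betw_bipartition_pointed[OF u], symmetric])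
  also have "\<dots> = (\<Sum>A\<in>Pow (verts G - {u}). {#expo G A#})"
    using lookup_toric_monomial_bipartition[OF G] by (intro sum.cong) auto
  finally show ?thesis .
qed

text \<open>With \<open>join\<close> for \<open>h\<close>, this counts the columns of the matrix of
  all stacked pairs by pairs of subsets.\<close>

lemma mset_combinations:
  assumes Fs: "mset Fs = (\<Sum>a\<in>P. {#f a#})" and Gs: "mset Gs = (\<Sum>b\<in>Q. {#g b#})"
  shows "mset [h \<phi> \<psi>. \<phi> \<leftarrow> Fs, \<psi> \<leftarrow> Gs] = (\<Sum>a\<in>P. \<Sum>b\<in>Q. {#h (f a) (g b)#})"
proof -
  have im: "(\<Sum>a\<in>P. {#f a#}) = image_mset f (mset_set P)" for f :: "'x \<Rightarrow> 'y" and P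
    by (simp add: sum_unfold_sum_mset)
  have "mset [h \<phi> \<psi>. \<phi> \<leftarrow> Fs, \<psi> \<leftarrow> Gs] = (\<Sum>\<phi>\<in>#mset Fs. image_mset (h \<phi>) (mset Gs))"
    by (induction Fs) auto
  also have "\<dots> = (\<Sum>a\<in>P. image_mset (h (f a)) (mset Gs))"
    unfolding Fs im by (simp add: sum_unfold_sum_mset image_mset.compositionality comp_def)
  also have "\<dots> = (\<Sum>a\<in>P. \<Sum>b\<in>Q. {#h (f a) (g b)#})"
    unfolding Gs im by (simp add: image_mset.compositionality comp_def)
  finally show ?thesis .
qed

section \<open>Disjoint unions and clique sums\<close>

lemma pair_edges_disj_union:
  assumes "pair_edges G" "pair_edges H"
  shows "pair_edges (disj_union G H)"
proof -
  have "\<exists>x\<in>verts G <+> verts H. \<exists>y\<in>verts G <+> verts H. e = {x, y}"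
    if e: "e \<in> (`) Inl ` edges G \<union> (`) Inr ` edges H" for e
  proof (cases "e \<in> (`) Inl ` edges G")
    case True
    then obtain d where "d \<in> edges G" "e = Inl ` d" by blast
    moreover from this obtain x y where "x \<in> verts G" "y \<in> verts G" "d = {x, y}"
      using pair_edgesE[OF assms(1)] by metis
    ultimately show ?thesis by (intro bexI[of _ "Inl x"] bexI[of _ "Inl y"]) auto
  next
    case False
    then obtain d where "d \<in> edges H" "e = Inr ` d" using e by blast
    moreover from this obtain x y where "x \<in> verts H" "y \<in> verts H" "d = {x, y}"
      using pair_edgesE[OF assms(2)] by metis
    ultimately show ?thesis by (intro bexI[of _ "Inr x"] bexI[of _ "Inr y"]) auto
  qed
  then show ?thesis using assms by (simp add: pair_edges_def disj_union_def)
qed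

lemma pair_edges_map_verts:
  assumes "pair_edges G"
  shows "pair_edges (map_verts f G)"
proof -
  have "\<exists>x\<in>f ` verts G. \<exists>y\<in>f ` verts G. f ` e = {x, y}" if e: "e \<in> edges G" for e
  proof -
    obtain x y where "x \<in> verts G" "y \<in> verts G" "e = {x, y}" using assms e by (rule pair_edgesE)
    then show ?thesis by (intro bexI[of _ "f x"] bexI[of _ "f y"]) auto
  qed
  then show ?thesis using assms by (simp add: pair_edges_def map_verts_def)
qed

lemma crosses_Plus [simp]:
  "crosses (A <+> C) (Inl ` e) = crosses A e" "crosses (A <+> C) (Inr ` d) = crosses C d"
  unfolding crosses_def by auto

lemma expo_disj_union:
  assumes G: "pair_edges G" and H: "pair_edges H"
  shows "expo (disj_union G H) (A <+> C) = join (expo G A) (expo H C)"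
proof
  fix x :: "('b + 'd) tvar"
  let ?D = "disj_union G H"
  let ?h = "\<lambda>e. if x = (if crosses (A <+> C) e then S_var (lab ?D e) else T_var (lab ?D e))
    then mult ?D e else 0"
  \<comment> \<open>The empty set has the same image under \<open>Inl\<close> and
    \<open>Inr\<close>, so the two copies of the edge sets are disjoint only because edges are
    nonempty.\<close>
  have ne: "e \<noteq> {}" if "e \<in> edges G" for e
    using G that by (rule pair_edgesE) simp
  have disj: "(`) Inl ` edges G \<inter> (`) Inr ` edges H = {}"
  proof -
    have "Inl ` e \<noteq> Inr ` d" if e: "e \<in> edges G" for e :: "'a set" and d :: "'c set"
    proof -
      obtain x where "x \<in> e" using ne[OF e] by blast
      then have "Inl x \<in> Inl ` e" "Inl x \<notin> Inr ` d" by auto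
      then show ?thesis by metis
    qed
    then show ?thesis by blast
  qed
  have inj: "inj_on ((`) Inl) (edges G)" "inj_on ((`) Inr) (edges H)"
    by (auto simp: inj_on_def inj_image_eq_iff)
  have vim: "Inl -` (Inl ` e) = e" "Inr -` (Inr ` d) = d" for e :: "'a set" and d :: "'c set"
    by auto
  have lG: "lab ?D (Inl ` e) = Inl (lab G e)" "mult ?D (Inl ` e) = mult G e"
    if "e \<in> edges G" for e
    using that by (auto simp: disj_union_def vim)
  have lH: "lab ?D (Inr ` e) = Inr (lab H e)" "mult ?D (Inr ` e) = mult H e"
    if "e \<in> edges H" for e
  proof -
    have "Inr ` e \<notin> (`) Inl ` edges G" using that disj by blast
    then show "lab ?D (Inr ` e) = Inr (lab H e)" "mult ?D (Inr ` e) = mult H e"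
      by (auto simp: disj_union_def vim)
  qed
  have "expo ?D (A <+> C) x = sum ?h ((`) Inl ` edges G) + sum ?h ((`) Inr ` edges H)"
    unfolding expo_def
    using sum.union_disjoint[OF _ _ disj, of ?h] pair_edges_finite[OF G] pair_edges_finite[OF H]
    by (simp add: disj_union_def)
  also have "\<dots> = (\<Sum>e\<in>edges G. ?h (Inl ` e)) + (\<Sum>e\<in>edges H. ?h (Inr ` e))"
    by (simp only: sum.reindex[OF inj(1)] sum.reindex[OF inj(2)] comp_def)
  finally have 1: "expo ?D (A <+> C) x =
    (\<Sum>e\<in>edges G. ?h (Inl ` e)) + (\<Sum>e\<in>edges H. ?h (Inr ` e))" .
  have "(\<Sum>e\<in>edges G. ?h (Inl ` e)) = (\<Sum>e\<in>edges G.
      if x = (if crosses A e then S_var (Inl (lab G e)) else T_var (Inl (lab G e)))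
      then mult G e else 0)"
    by (rule sum.cong) (simp_all add: lG)
  \<comment> \<open>Copies of edges of \<open>G\<close> carry labels under \<open>Inl\<close> and
    contribute 0 to the variables of \<open>H\<close>. The split by \<open>join.cases\<close> runs
    over the four shapes of \<open>x\<close>.\<close>
  also have "\<dots> = join (expo G A) (\<lambda>_. 0) x"
    by (cases "(expo G A, expo H C, x)" rule: join.cases)
       (auto simp: expo_def intro!: sum.cong sum.neutral)
  finally have 2: "(\<Sum>e\<in>edges G. ?h (Inl ` e)) = join (expo G A) (\<lambda>_. 0) x" .
  have "(\<Sum>e\<in>edges H. ?h (Inr ` e)) = (\<Sum>e\<in>edges H.
      if x = (if crosses C e then S_var (Inr (lab H e)) else T_var (Inr (lab H e)))
      then mult H e else 0)"
    by (rule sum.cong) (simp_all add: lH)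
  also have "\<dots> = join (\<lambda>_. 0) (expo H C) x"
    by (cases "(expo G A, expo H C, x)" rule: join.cases)
       (auto simp: expo_def intro!: sum.cong sum.neutral)
  finally have 3: "(\<Sum>e\<in>edges H. ?h (Inr ` e)) = join (\<lambda>_. 0) (expo H C) x" .
  have "join (expo G A) (\<lambda>_. 0) x + join (\<lambda>_. 0) (expo H C) x = join (expo G A) (expo H C) x"
    by (cases "(expo G A, expo H C, x)" rule: join.cases) simp_all
  then show "expo ?D (A <+> C) x = join (expo G A) (expo H C) x" by (simp only: 1 2 3)
qed

text \<open>The image of an edge under \<open>f\<close> crosses \<open>B\<close> exactly when the
  edge crosses the preimage of \<open>B\<close>. Injectivity on edges allows reindexing the sum and
  lets \<open>inv_into\<close> recover label and multiplicity.\<close>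

lemma expo_map_verts:
  assumes "inj_on ((`) f) (edges G)"
  shows "expo (map_verts f G) B = expo G (f -` B)"
  unfolding expo_def map_verts_def fun_eq_iff
  using assms by (auto simp: sum.reindex crosses_image inv_into_f_f intro!: sum.cong)

text \<open>This makes \<open>expo_map_verts\<close> applicable to the clique sum. Simplicity of
  \<open>H\<close> matters: a loop at \<open>v\<close> would coincide with a loop of
  \<open>G\<close> at \<open>u\<close>.\<close>

lemma inj_on_edges_identify:
  assumes G: "pair_edges G" and H: "simple_graph (verts H) (edges H)"
  shows "inj_on ((`) (\<lambda>z. if z = Inr v then Inl u else z)) (edges (disj_union G H))"
proof -
  let ?f = "\<lambda>z. if z = Inr v then Inl u else z"
  have fl: "?f ` (Inl ` e) = Inl ` e" for e :: "'a set" by force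
  \<comment> \<open>Every edge of \<open>H\<close> keeps an endpoint in \<open>H\<close>, which tells the images apart.\<close>
  have fr: "\<exists>y. Inr y \<in> ?f ` (Inr ` e)" if "e \<in> edges H" for e
  proof -
    obtain x y where "x \<noteq> y" "e = {x, y}" using H \<open>e \<in> edges H\<close> unfolding simple_graph_def by meson
    then obtain z where "z \<in> e" "z \<noteq> v" by (cases "x = v") auto
    then show ?thesis by force
  qed
  \<comment> \<open>An edge of \<open>H\<close> is read off from its image: its vertices other than
    \<open>v\<close> stay under \<open>Inr\<close>, and \<open>v\<close> belongs to it exactly when
    \<open>Inl u\<close> is in the image.\<close>
  have rec: "e = {z. z \<noteq> v \<and> Inr z \<in> ?f ` (Inr ` e)} \<union> {z. z = v \<and> Inl u \<in> ?f ` (Inr ` e)}"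
    for e :: "'c set" by (auto simp: image_iff split: if_splits)
  have inj_r: "e = e'" if "?f ` (Inr ` e) = ?f ` (Inr ` e')" for e e' :: "'c set"
    by (subst rec[of e], subst rec[of e']) (simp only: that)
  show ?thesis
  proof (rule inj_onI)
    fix d d' assume d: "d \<in> edges (disj_union G H)" and d': "d' \<in> edges (disj_union G H)"
      and eq: "?f ` d = ?f ` d'"
    consider (ll) e e' where "d = Inl ` e" "d' = Inl ` e'"
      | (lr) e e' where "e' \<in> edges H" "d = Inl ` e" "d' = Inr ` e'"
      | (rl) e e' where "e \<in> edges H" "d = Inr ` e" "d' = Inl ` e'"
      | (rr) e e' where "d = Inr ` e" "d' = Inr ` e'"
      using d d' unfolding disj_union_def by auto
    then show "d = d'"
    proof cases
      case ll then show ?thesis using eq by (simp only: fl)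
    next
      case lr
      obtain y where "Inr y \<in> ?f ` d'" using fr[OF lr(1)] lr(3) by blast
      moreover have "?f ` d' = Inl ` e" by (simp only: eq[symmetric] lr(2) fl)
      ultimately show ?thesis by auto
    next
      case rl
      obtain y where "Inr y \<in> ?f ` d" using fr[OF rl(1)] rl(2) by blast
      moreover have "?f ` d = Inl ` e'" by (simp only: eq rl(3) fl)
      ultimately show ?thesis by auto
    next
      case rr
      have "e = e'" by (rule inj_r) (use eq in \<open>simp only: rr\<close>)
      then show ?thesis by (simp only: rr)
    qed
  qed
qed

section \<open>Subsets and row variables of a disjoint sum\<close>

lemma bij_betw_Plus_Pow:
  "bij_betw (\<lambda>(A, C). A <+> C) (Pow P \<times> Pow Q) (Pow (P <+> Q))"
proof (rule bij_betw_imageI)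
  have *: "A = Inl -` (A <+> C)" "C = Inr -` (A <+> C)" for A :: "'x set" and C :: "'y set"
    by auto
  show "inj_on (\<lambda>(A, C). A <+> C) (Pow P \<times> Pow Q)"
  proof (rule inj_onI)
    fix x y :: "'a set \<times> 'b set"
    assume "(case x of (A, C) \<Rightarrow> A <+> C) = (case y of (A, C) \<Rightarrow> A <+> C)"
    then have "fst x <+> snd x = fst y <+> snd y" by (simp add: case_prod_unfold)
    then have "fst x = fst y" "snd x = snd y" by (metis *(1), metis *(2))
    then show "x = y" by (rule prod_eqI)
  qed
  show "(\<lambda>(A, C). A <+> C) ` (Pow P \<times> Pow Q) = Pow (P <+> Q)"
  proof
    show "Pow (P <+> Q) \<subseteq> (\<lambda>(A, C). A <+> C) ` (Pow P \<times> Pow Q)"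
    proof
      fix X assume X: "X \<in> Pow (P <+> Q)"
      have "X = (Inl -` X) <+> (Inr -` X)"
      proof (rule Set.set_eqI)
        show "z \<in> X \<longleftrightarrow> z \<in> (Inl -` X) <+> (Inr -` X)" for z by (cases z) auto
      qed
      moreover have "(Inl -` X, Inr -` X) \<in> Pow P \<times> Pow Q" using X by auto
      ultimately show "X \<in> (\<lambda>(A, C). A <+> C) ` (Pow P \<times> Pow Q)"
        by (metis (mono_tags, lifting) case_prod_conv image_eqI)
    qed
  qed auto
qed

lemma sum_Pow_Plus:
  "(\<Sum>X\<in>Pow (P <+> Q). h X) = (\<Sum>A\<in>Pow P. \<Sum>C\<in>Pow Q. h (A <+> C))"
  unfolding sum.cartesian_product
  by (subst sum.reindex_bij_betw[OF bij_betw_Plus_Pow, symmetric]) (simp add: case_prod_unfold)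

text \<open>Complementation in \<open>W\<close> matches the subsets avoiding \<open>w\<close> with
  those containing \<open>w\<close>, so the sum is grouped by partitions of
  \<open>W\<close>.\<close>

lemma sum_Pow_pointed:
  assumes "finite W" and "w \<in> W"
  shows "(\<Sum>C\<in>Pow W. h C) = (\<Sum>C\<in>Pow (W - {w}). h C + h (W - C))"
proof -
  let ?P = "Pow (W - {w})"
  have inj: "inj_on ((-) W) ?P" by (rule inj_onI) blast
  have "Pow W \<subseteq> ?P \<union> (-) W ` ?P"
  proof
    fix C assume C: "C \<in> Pow W"
    show "C \<in> ?P \<union> (-) W ` ?P"
    proof (cases "w \<in> C")
      case True
      then have "W - C \<in> ?P" "C = W - (W - C)" using C by auto
      then show ?thesis by blast
    qed (use C in auto)
  qed
  then have "Pow W = ?P \<union> (-) W ` ?P" using assms by auto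
  moreover have "?P \<inter> (-) W ` ?P = {}" using assms by auto
  ultimately have "(\<Sum>C\<in>Pow W. h C) = sum h ?P + sum h ((-) W ` ?P)"
    using assms by (metis finite_Diff finite_Pow_iff finite_imageI sum.union_disjoint)
  then show ?thesis by (simp add: sum.reindex[OF inj] sum.distrib)
qed

text \<open>Both lists are distinct and have the same elements. Only the order differs: all
  \<open>s\<close> before all \<open>t\<close> in one, the rows of \<open>G\<close> before those of
  \<open>H\<close> in the other.\<close>

lemma mset_row_vars_Plus:
  assumes "enumerates ds (A <+> B)" "enumerates as A" "enumerates bs B"
  shows "mset (row_vars ds) = mset (hash_row_vars as bs)"
proof -
  have d: "distinct (row_vars xs)" if "distinct xs" for xs :: "'x list"
    using that by (auto simp: row_vars_def distinct_map inj_on_def)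
  have inj: "inj (map_tvar Inl)" "inj (map_tvar Inr)"
    by (rule tvar.inj_map; simp)+
  have neq: "map_tvar Inl x \<noteq> map_tvar Inr y" for x :: "'x tvar" and y :: "'y tvar"
    by (cases x; cases y) auto
  have "distinct (row_vars ds)" "distinct (hash_row_vars as bs)"
    using assms neq inj
    by (auto simp: enumerates_def hash_row_vars_def d distinct_map intro: inj_on_subset)
  moreover have "set (row_vars ds) = set (hash_row_vars as bs)"
    using assms by (auto simp: enumerates_def hash_row_vars_def row_vars_def image_iff)
  ultimately show ?thesis by (simp add: set_eq_iff_mset_eq_distinct)
qed

lemma toric_mat_disj_union:
  assumes G: "pair_edges G" and u: "u \<in> verts G" and H: "pair_edges H" and w: "w \<in> verts H"
    and as: "enumerates as (labels G)" and ps: "enumerates ps (partitions (verts G))"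
    and bs: "enumerates bs (labels H)" and qs: "enumerates qs (partitions (verts H))"
    and ds: "enumerates ds (labels (disj_union G H))"
    and rs: "enumerates rs (partitions (verts (disj_union G H)))"
  shows "eq_up_to_order (row_vars ds) (toric_mat (disj_union G H) ds rs) (hash_row_vars as bs)
    (repeat_cols_twice (hash_mat (toric_mat G as ps) (toric_mat H bs qs)))"
proof -
  let ?D = "disj_union G H"
  let ?Fs = "map (\<lambda>p. Poly_Mapping.lookup (toric_monomial G p)) ps"
  let ?Gs = "map (\<lambda>p. Poly_Mapping.lookup (toric_monomial H p)) qs"
  let ?P = "Pow (verts G - {u})" and ?Q = "Pow (verts H - {w})"
  have D: "pair_edges ?D" by (rule pair_edges_disj_union[OF G H])
  have vD: "verts ?D = verts G <+> verts H" by (simp add: disj_union_def)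
  \<comment> \<open>One base point, taken in \<open>G\<close>, suffices for the union, so the part
    of a side in \<open>H\<close> ranges over all subsets.\<close>
  have vD': "verts ?D - {Inl u} = (verts G - {u}) <+> verts H"
    unfolding vD by auto
  have fin: "finite (verts H)" using H by (simp add: pair_edges_def)
  have "mset (map (\<lambda>p. Poly_Mapping.lookup (toric_monomial ?D p)) rs)
    = (\<Sum>X\<in>Pow (verts ?D - {Inl u}). {#expo ?D X#})"
    by (rule mset_toric_columns[OF D _ rs]) (use u vD in auto)
  also have "\<dots> = (\<Sum>A\<in>?P. \<Sum>C\<in>Pow (verts H). {#join (expo G A) (expo H C)#})"
    by (simp only: vD' sum_Pow_Plus expo_disj_union[OF G H])
  \<comment> \<open>A subset of \<open>verts H\<close> and its complement stack to the same column,
    which splits the count into two equal halves.\<close>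
  also have "\<dots> = (\<Sum>A\<in>?P. \<Sum>C\<in>?Q. {#join (expo G A) (expo H C)#})
    + (\<Sum>A\<in>?P. \<Sum>C\<in>?Q. {#join (expo G A) (expo H C)#})"
    by (simp only: sum_Pow_pointed[OF fin w] expo_complement[OF H] sum.distrib)
  also have "(\<Sum>A\<in>?P. \<Sum>C\<in>?Q. {#join (expo G A) (expo H C)#}) =
      mset [join \<phi> \<psi>. \<phi> \<leftarrow> ?Fs, \<psi> \<leftarrow> ?Gs]"
    by (rule mset_combinations[OF mset_toric_columns[OF G u ps] mset_toric_columns[OF H w qs], symmetric])
  finally have cols: "mset (map (\<lambda>p. Poly_Mapping.lookup (toric_monomial ?D p)) rs) =
      mset ([join \<phi> \<psi>. \<phi> \<leftarrow> ?Fs, \<psi> \<leftarrow> ?Gs] @ [join \<phi> \<psi>. \<phi> \<leftarrow> ?Fs, \<psi> \<leftarrow> ?Gs])"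
    by (simp only: mset_append)
  have rows: "mset (row_vars ds) = mset (hash_row_vars as bs)"
    using mset_row_vars_Plus[OF _ as bs] ds by (simp add: disj_union_def)
  show ?thesis
    unfolding toric_mat_eq_mat_of_funs hash_mat_of_funs repeat_cols_twice_mat_of_funs
      hash_row_vars_def[symmetric]
    by (rule eq_up_to_order_mat_of_funs[OF rows cols])
qed

lemma toric_mat_zero_sum:
  assumes G: "pair_edges G" and u: "u \<in> verts G"
    and H: "simple_graph (verts H) (edges H)" and w: "w \<in> verts H"
    and as: "enumerates as (labels G)" and ps: "enumerates ps (partitions (verts G))"
    and bs: "enumerates bs (labels H)" and qs: "enumerates qs (partitions (verts H))"
    and ds: "enumerates ds (labels (zero_sum u w G H))"
    and rs: "enumerates rs (partitions (verts (zero_sum u w G H)))"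
  shows "eq_up_to_order (row_vars ds) (toric_mat (zero_sum u w G H) ds rs) (hash_row_vars as bs)
    (hash_mat (toric_mat G as ps) (toric_mat H bs qs))"
proof -
  let ?D = "disj_union G H" and ?Z = "zero_sum u w G H"
  let ?f = "\<lambda>z. if z = Inr w then Inl u else z"
  let ?Fs = "map (\<lambda>p. Poly_Mapping.lookup (toric_monomial G p)) ps"
  let ?Gs = "map (\<lambda>p. Poly_Mapping.lookup (toric_monomial H p)) qs"
  let ?P = "Pow (verts G - {u})" and ?Q = "Pow (verts H - {w})"
  note H' = pair_edges_if_simple_graph[OF H]
  have Z: "pair_edges ?Z"
    unfolding zero_sum_def by (intro pair_edges_map_verts pair_edges_disj_union G H')
  have vZ: "verts ?Z = ?f ` (verts G <+> verts H)"
    by (simp add: zero_sum_def map_verts_def disj_union_def)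
  have uZ: "Inl u \<in> verts ?Z" unfolding vZ using u by (intro image_eqI[of _ _ "Inl u"]) auto
  have vZ': "verts ?Z - {Inl u} = (verts G - {u}) <+> (verts H - {w})"
    unfolding vZ by (auto simp: image_iff)
  have ex: "expo ?Z (A <+> C) = join (expo G A) (expo H C)" if "A \<in> ?P" "C \<in> ?Q" for A C
  proof -
    \<comment> \<open>The identification moves only \<open>Inr w\<close>, to \<open>Inl u\<close>;
      since \<open>w\<close> is not in \<open>C\<close> and \<open>u\<close> is not in
      \<open>A\<close>, the preimage is unchanged.\<close>
    have "?f -` (A <+> C) = A <+> C" using that by (auto split: if_splits)
    then show ?thesis
      unfolding zero_sum_def expo_map_verts[OF inj_on_edges_identify[OF G H]]
      by (simp only: expo_disj_union[OF G H'])
  qed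
  have "mset (map (\<lambda>p. Poly_Mapping.lookup (toric_monomial ?Z p)) rs)
    = (\<Sum>X\<in>Pow (verts ?Z - {Inl u}). {#expo ?Z X#})"
    by (rule mset_toric_columns[OF Z uZ rs])
  also have "\<dots> = (\<Sum>A\<in>?P. \<Sum>C\<in>?Q. {#expo ?Z (A <+> C)#})"
    by (simp only: vZ' sum_Pow_Plus)
  also have "\<dots> = (\<Sum>A\<in>?P. \<Sum>C\<in>?Q. {#join (expo G A) (expo H C)#})"
    by (intro sum.cong refl) (simp only: ex)
  also have "\<dots> = mset [join \<phi> \<psi>. \<phi> \<leftarrow> ?Fs, \<psi> \<leftarrow> ?Gs]"
    by (rule mset_combinations[OF mset_toric_columns[OF G u ps] mset_toric_columns[OF H' w qs], symmetric])
  finally have cols: "mset (map (\<lambda>p. Poly_Mapping.lookup (toric_monomial ?Z p)) rs) =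
      mset [join \<phi> \<psi>. \<phi> \<leftarrow> ?Fs, \<psi> \<leftarrow> ?Gs]" .
  have rows: "mset (row_vars ds) = mset (hash_row_vars as bs)"
    using mset_row_vars_Plus[OF _ as bs] ds by (simp add: zero_sum_def map_verts_def disj_union_def)
  show ?thesis
    unfolding toric_mat_eq_mat_of_funs hash_mat_of_funs hash_row_vars_def[symmetric]
    by (rule eq_up_to_order_mat_of_funs[OF rows cols])
qed

section \<open>Left factors in block form\<close>

lemma block_diag_carrier:
  "X \<in> carrier_mat r c \<Longrightarrow> Y \<in> carrier_mat r c \<Longrightarrow> block_diag X Y \<in> carrier_mat (2 * r) (2 * c)"
  unfolding block_diag_def by auto

text \<open>The inner index splits at \<open>c\<close>, and the zero blocks remove one half of each
  scalar product: \<open>X\<close> sees only the upper half of \<open>M\<close>, \<open>Y\<close>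
  only the lower.\<close>

lemma index_block_diag_mult:
  fixes M :: "'c::semiring_0 mat"
  assumes X: "X \<in> carrier_mat r c" and Y: "Y \<in> carrier_mat r c"
    and M: "M \<in> carrier_mat (2 * c) n" and i: "i < r" and j: "j < n"
  shows "(block_diag X Y * M) $$ (i, j) = (\<Sum>t<c. X $$ (i, t) * M $$ (t, j))"
    and "(block_diag X Y * M) $$ (r + i, j) = (\<Sum>t<c. Y $$ (i, t) * M $$ (c + t, j))"
proof -
  have sum: "(\<Sum>t\<in>{0..<2 * c}. h t) = (\<Sum>t<c. h t) + (\<Sum>t<c. h (c + t))" for h :: "nat \<Rightarrow> 'c"
    by (simp add: mult_2 lessThan_atLeast0 sum.atLeastLessThan_concat[of 0 c "c + c", symmetric]
        sum.atLeastLessThan_shift_0[of h c "c + c"])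
  have ent: "(block_diag X Y * M) $$ (k, j) = (\<Sum>t\<in>{0..<2 * c}. block_diag X Y $$ (k, t) * M $$ (t, j))"
    if "k < 2 * r" for k
    using that block_diag_carrier[OF X Y] M j by (auto simp: scalar_prod_def intro!: sum.cong)
  show "(block_diag X Y * M) $$ (i, j) = (\<Sum>t<c. X $$ (i, t) * M $$ (t, j))"
    using X Y i by (subst ent) (auto simp: sum block_diag_def)
  show "(block_diag X Y * M) $$ (r + i, j) = (\<Sum>t<c. Y $$ (i, t) * M $$ (c + t, j))"
    using X Y i by (subst ent) (auto simp: sum block_diag_def)
qed

lemma toric_mat_carrier: "toric_mat G as ps \<in> carrier_mat (2 * length as) (length ps)"
  by (simp add: toric_mat_def)

lemma index_toric_mat:
  assumes "i < length as" "j < length ps"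
  shows "toric_mat G as ps $$ (i, j) =
      Poly_Mapping.lookup (toric_monomial G (ps ! j)) (S_var (as ! i))"
    and "toric_mat G as ps $$ (length as + i, j) =
      Poly_Mapping.lookup (toric_monomial G (ps ! j)) (T_var (as ! i))"
  using assms by (auto simp: toric_mat_def row_vars_def nth_append)

lemma toric_mat_eq_block_diag_mult:
  assumes B: "B \<in> carrier_mat (length cs) (length as)"
    and S: "\<And>i j. i < length cs \<Longrightarrow> j < length ps \<Longrightarrow>
      Poly_Mapping.lookup (toric_monomial G' (ps ! j)) (S_var (cs ! i)) =
      (\<Sum>t<length as. B $$ (i, t) * Poly_Mapping.lookup (toric_monomial G (ps ! j)) (S_var (as ! t)))"
    and T: "\<And>i j. i < length cs \<Longrightarrow> j < length ps \<Longrightarrow>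
      Poly_Mapping.lookup (toric_monomial G' (ps ! j)) (T_var (cs ! i)) =
      (\<Sum>t<length as. B $$ (i, t) * Poly_Mapping.lookup (toric_monomial G (ps ! j)) (T_var (as ! t)))"
  shows "toric_mat G' cs ps = block_diag B B * toric_mat G as ps"
proof (rule eq_matI)
  note M = toric_mat_carrier[of G as ps]
  show "dim_row (toric_mat G' cs ps) = dim_row (block_diag B B * toric_mat G as ps)"
    "dim_col (toric_mat G' cs ps) = dim_col (block_diag B B * toric_mat G as ps)"
    using block_diag_carrier[OF B B] M toric_mat_carrier[of G' cs ps] by auto
  fix i j assume "i < dim_row (block_diag B B * toric_mat G as ps)"
    "j < dim_col (block_diag B B * toric_mat G as ps)"
  then have i: "i < 2 * length cs" and j: "j < length ps"
    using block_diag_carrier[OF B B] M by auto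
  show "toric_mat G' cs ps $$ (i, j) = (block_diag B B * toric_mat G as ps) $$ (i, j)"
  proof (cases "i < length cs")
    case True
    then show ?thesis
      using index_block_diag_mult(1)[OF B B M True j] S j by (simp add: index_toric_mat)
  next
    case False
    define k where "k = i - length cs"
    then have k: "i = length cs + k" "k < length cs" using False i by auto
    then show ?thesis
      using index_block_diag_mult(2)[OF B B M k(2) j] T j by (simp add: index_toric_mat)
  qed
qed

section \<open>Existence of the factors: relabelling and multiplicities\<close>

lemma sum_nth_delta:
  fixes h :: "nat \<Rightarrow> 'c::comm_monoid_add"
  assumes "distinct xs" "t < length xs"
  shows "(\<Sum>s<length xs. if xs ! s = xs ! t then h s else 0) = h t"
proof -
  have "(\<Sum>s<length xs. if xs ! s = xs ! t then h s else 0) =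
    (\<Sum>s<length xs. if s = t then h s else 0)"
    by (rule sum.cong) (use assms in \<open>auto simp: nth_eq_iff_index_eq\<close>)
  then show ?thesis using assms by simp
qed

text \<open>Cuts ignore labels, so the row of a new label is the sum of the rows of the old labels
  that \<open>r\<close> sends to it. Starting from canonical labels with \<open>r\<close> equal to
  \<open>l\<close> this is iii); redirecting one label to another gives iii.bis).\<close>

lemma toric_mat_relabel:
  assumes G: "finite (edges G)" and as: "enumerates as (labels G)"
    and lab: "lab G ` edges G = labels G"
    and G': "edges G' = edges G" "lab G' = (\<lambda>e. r (lab G e))" "mult G' = mult G"
    and B: "B = mat (length cs) (length as) (\<lambda>(i, j). if cs ! i = r (as ! j) then 1 else 0)"
  shows "toric_mat G' cs ps = block_diag B B * toric_mat G as ps"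
proof (rule toric_mat_eq_block_diag_mult)
  have cut: "cut G' p = cut G p" for p using G' by (simp add: cut_def)
  \<comment> \<open>\<open>P\<close> stands for lying in the cut (for \<open>s\<close>-rows) or
    outside it (for \<open>t\<close>-rows). After exchanging the sums, each edge meets its label at
    exactly one position of \<open>as\<close>.\<close>
  have key: "(\<Sum>e\<in>edges G. if P e \<and> c = r (lab G e) then mult G e else 0) =
    (\<Sum>t<length as. (if c = r (as ! t) then 1 else 0) *
      (\<Sum>e\<in>edges G. if P e \<and> as ! t = lab G e then mult G e else 0))" for P c
  proof -
    have "(\<Sum>t<length as. (if c = r (as ! t) then 1 else 0) *
        (\<Sum>e\<in>edges G. if P e \<and> as ! t = lab G e then mult G e else 0)) =
      (\<Sum>e\<in>edges G. \<Sum>t<length as. (if c = r (as ! t) then 1 else 0) *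
        (if P e \<and> as ! t = lab G e then mult G e else 0))"
      unfolding sum_distrib_left by (rule sum.swap)
    also have "\<dots> = (\<Sum>e\<in>edges G. if P e \<and> c = r (lab G e) then mult G e else 0)"
    proof (rule sum.cong[OF refl])
      fix e assume "e \<in> edges G"
      then have "lab G e \<in> set as" using as lab by (auto simp: enumerates_def)
      then obtain t where t: "t < length as" "as ! t = lab G e" by (auto simp: in_set_conv_nth)
      have "(\<Sum>s<length as. (if c = r (as ! s) then 1 else 0) *
          (if P e \<and> as ! s = lab G e then mult G e else 0)) =
        (\<Sum>s<length as. if as ! s = as ! t
          then (if P e \<and> c = r (lab G e) then mult G e else 0) else 0)"
        by (rule sum.cong) (auto simp: t)
      also have "\<dots> = (if P e \<and> c = r (lab G e) then mult G e else 0)"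
        using as t(1) by (intro sum_nth_delta) (auto simp: enumerates_def)
      finally show "(\<Sum>s<length as. (if c = r (as ! s) then 1 else 0) *
          (if P e \<and> as ! s = lab G e then mult G e else 0)) =
        (if P e \<and> c = r (lab G e) then mult G e else 0)" .
    qed
    finally show ?thesis by simp
  qed
  have S: "Poly_Mapping.lookup (toric_monomial K p) (S_var a) =
      (\<Sum>e\<in>edges K. if e \<in> cut K p \<and> a = lab K e then mult K e else 0)"
    and T: "Poly_Mapping.lookup (toric_monomial K p) (T_var a) =
      (\<Sum>e\<in>edges K. if e \<notin> cut K p \<and> a = lab K e then mult K e else 0)"
    if "finite (edges K)" for K :: "('v, 'x) lgraph" and p a
    unfolding lookup_toric_monomial[OF that] by (auto intro!: sum.cong)
  note fin' = G[folded G'(1)]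
  show "B \<in> carrier_mat (length cs) (length as)" by (simp add: B)
  fix i j assume i: "i < length cs"
  show "Poly_Mapping.lookup (toric_monomial G' (ps ! j)) (S_var (cs ! i)) =
      (\<Sum>t<length as. B $$ (i, t) * Poly_Mapping.lookup (toric_monomial G (ps ! j)) (S_var (as ! t)))"
    unfolding S[OF G] S[OF fin'] cut unfolding G' key using i by (simp add: B)
  show "Poly_Mapping.lookup (toric_monomial G' (ps ! j)) (T_var (cs ! i)) =
      (\<Sum>t<length as. B $$ (i, t) * Poly_Mapping.lookup (toric_monomial G (ps ! j)) (T_var (as ! t)))"
    unfolding T[OF G] T[OF fin'] cut unfolding G' key using i by (simp add: B)
qed

lemma lookup_canonical:
  assumes "finite (edges G)" "lab G = (\<lambda>e. e)" "e \<in> edges G"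
  shows "Poly_Mapping.lookup (toric_monomial G p) (S_var e) = (if e \<in> cut G p then mult G e else 0)"
    and "Poly_Mapping.lookup (toric_monomial G p) (T_var e) = (if e \<in> cut G p then 0 else mult G e)"
proof -
  have "Poly_Mapping.lookup (toric_monomial G p) (S_var e) =
      (\<Sum>d\<in>edges G. if d = e then (if e \<in> cut G p then mult G e else 0) else 0)"
    unfolding lookup_toric_monomial[OF assms(1)]
    by (rule sum.cong[OF refl]) (auto simp: assms(2))
  moreover have "Poly_Mapping.lookup (toric_monomial G p) (T_var e) =
      (\<Sum>d\<in>edges G. if d = e then (if e \<in> cut G p then 0 else mult G e) else 0)"
    unfolding lookup_toric_monomial[OF assms(1)]
    by (rule sum.cong[OF refl]) (auto simp: assms(2))
  ultimately show "Poly_Mapping.lookup (toric_monomial G p) (S_var e) = (if e \<in> cut G p then mult G e else 0)"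
    and "Poly_Mapping.lookup (toric_monomial G p) (T_var e) = (if e \<in> cut G p then 0 else mult G e)"
    using assms by simp_all
qed

text \<open>Under canonical labels a row involves a single edge, and cuts ignore multiplicities, so
  each row is just scaled.\<close>

lemma toric_mat_with_mult:
  assumes E: "finite E" and es: "enumerates es E"
    and B: "B = mat_diag (length es) (\<lambda>i. \<sigma> (es ! i))"
  shows "toric_mat (with_mult V E \<sigma>) es ps = block_diag B B * toric_mat (classical V E) es ps"
proof (rule toric_mat_eq_block_diag_mult)
  show "B \<in> carrier_mat (length es) (length es)" by (simp add: B)
  have cut: "cut (with_mult V E \<sigma>) p = cut (classical V E) p" for p
    by (simp add: cut_def with_mult_def classical_def)
  have row: "(\<Sum>t<length es. B $$ (i, t) * h t) = \<sigma> (es ! i) * h i" if "i < length es" for i h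
  proof -
    have "(\<Sum>t<length es. B $$ (i, t) * h t) =
        (\<Sum>t<length es. if t = i then \<sigma> (es ! i) * h i else 0)"
      using that by (intro sum.cong) (auto simp: B mat_diag_def)
    then show ?thesis using that by simp
  qed
  fix i j assume i: "i < length es"
  then have e: "es ! i \<in> E" using es by (auto simp: enumerates_def)
  have "finite (edges (with_mult V E \<sigma>))" "lab (with_mult V E \<sigma>) = (\<lambda>e. e)"
      "es ! i \<in> edges (with_mult V E \<sigma>)"
    using E e by (auto simp: with_mult_def)
  note 1 = lookup_canonical[OF this]
  have "finite (edges (classical V E))" "lab (classical V E) = (\<lambda>e. e)"
      "es ! i \<in> edges (classical V E)"
    using E e by (auto simp: classical_def)
  note 2 = lookup_canonical[OF this]
  show "Poly_Mapping.lookup (toric_monomial (with_mult V E \<sigma>) (ps ! j)) (S_var (es ! i)) =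
      (\<Sum>t<length es. B $$ (i, t) *
        Poly_Mapping.lookup (toric_monomial (classical V E) (ps ! j)) (S_var (es ! t)))"
    unfolding row[OF i] 1 2 cut by (simp add: with_mult_def classical_def)
  show "Poly_Mapping.lookup (toric_monomial (with_mult V E \<sigma>) (ps ! j)) (T_var (es ! i)) =
      (\<Sum>t<length es. B $$ (i, t) *
        Poly_Mapping.lookup (toric_monomial (classical V E) (ps ! j)) (T_var (es ! t)))"
    unfolding row[OF i] 1 2 cut by (simp add: with_mult_def classical_def)
qed

section \<open>Uniqueness of the factors\<close>

text \<open>An edge other than \<open>{x, y}\<close> crosses as many of the sets \<open>{x}\<close>, \<open>{y}\<close> as of
  \<open>{x, y}\<close>, \<open>{}\<close>, so its contributions cancel.\<close>

lemma expo_isolates_edge: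
  assumes G: "simple_graph (verts G) (edges G)" and e: "e \<in> edges G" "e = {x, y}"
    and K: "K = S_var \<and> z = 2 * mult G e \<or> K = T_var \<and> z = - 2 * mult G e"
  shows "expo G {x} (K a) + expo G {y} (K a) - expo G {x, y} (K a) - expo G {} (K a) =
    (if a = lab G e then z else 0)"
proof -
  let ?t = "\<lambda>A d. if K a = (if crosses A d then S_var (lab G d) else T_var (lab G d))
    then mult G d else 0"
  have fin: "finite (edges G)" by (rule pair_edges_finite[OF pair_edges_if_simple_graph[OF G]])
  have "expo G {x} (K a) + expo G {y} (K a) - expo G {x, y} (K a) - expo G {} (K a) =
    (\<Sum>d\<in>edges G. ?t {x} d + ?t {y} d - ?t {x, y} d - ?t {} d)"
    unfolding expo_def by (simp only: sum.distrib sum_subtractf)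
  also have "\<dots> = (\<Sum>d\<in>edges G. if d = e then (if a = lab G e then z else 0) else 0)"
  proof (rule sum.cong[OF refl])
    fix d assume d: "d \<in> edges G"
    then obtain v w where vw: "v \<noteq> w" "d = {v, w}" using G unfolding simple_graph_def by meson
    have "x \<noteq> y" using G e unfolding simple_graph_def by (metis insert_absorb2 doubleton_eq_iff)
    show "?t {x} d + ?t {y} d - ?t {x, y} d - ?t {} d =
      (if d = e then (if a = lab G e then z else 0) else 0)"
    proof (cases "d = e")
      case True
      \<comment> \<open>With the signs +, +, -, - the edge counts twice positively in its
        \<open>s\<close>-variable and twice negatively in its \<open>t\<close>-variable; this is the
        value \<open>z\<close>.\<close>
      have "crosses {x} d" "crosses {y} d" "\<not> crosses {x, y} d" "\<not> crosses {} d"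
        using \<open>x \<noteq> y\<close> by (auto simp: True e(2) crosses_pair)
      then show ?thesis using K True by auto
    next
      case False
      \<comment> \<open>Two distinct edges share at most one vertex: \<open>d\<close> contains only
        \<open>x\<close>, only \<open>y\<close>, or neither.\<close>
      then have "crosses {x} d \<and> \<not> crosses {y} d \<and> crosses {x, y} d \<and> \<not> crosses {} d \<or>
        \<not> crosses {x} d \<and> crosses {y} d \<and> crosses {x, y} d \<and> \<not> crosses {} d \<or>
        \<not> crosses {x} d \<and> \<not> crosses {y} d \<and> \<not> crosses {x, y} d \<and> \<not> crosses {} d"
        using vw \<open>x \<noteq> y\<close> unfolding vw(2) e(2) crosses_pair by auto
      then show ?thesis using False by auto
    qed
  qed
  also have "\<dots> = (if a = lab G e then z else 0)" using fin e by simp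
  finally show ?thesis .
qed

text \<open>The signed combination of four columns turns the relation into \<open>d t\<close> times
  \<open>z\<close>, as all edges but the chosen one cancel, even those with the same label. Here
  \<open>z\<close> is nonzero also in the ring, which has characteristic 0 and no zero
  divisors.\<close>

lemma toric_rows_independent:
  fixes d :: "nat \<Rightarrow> 'c::{idom,ring_char_0}"
  assumes G: "labelled_graph G" and as: "enumerates as (labels G)"
    and K: "K = S_var \<or> K = T_var"
    and 0: "\<And>p. p \<in> partitions (verts G) \<Longrightarrow>
      (\<Sum>t<length as. d t * of_int (Poly_Mapping.lookup (toric_monomial G p) (K (as ! t)))) = 0"
    and t: "t < length as"
  shows "d t = 0"
proof -
  have sg: "simple_graph (verts G) (edges G)" using G by (simp add: labelled_graph_def)
  \<comment> \<open>The labeling is surjective, so every label belongs to some edge.\<close>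
  have "as ! t \<in> lab G ` edges G"
    using as t G by (auto simp: enumerates_def labelled_graph_def is_labeling_def)
  then obtain e where e: "e \<in> edges G" "lab G e = as ! t" by force
  have m: "mult G e \<noteq> 0" using G e(1) by (simp add: labelled_graph_def is_multiplicity_def)
  obtain x y where xy: "x \<in> verts G" "y \<in> verts G" "e = {x, y}"
    using sg e(1) unfolding simple_graph_def by meson
  have ex0: "(\<Sum>s<length as. d s * of_int (expo G A (K (as ! s)))) = 0" if "A \<subseteq> verts G" for A
    using 0[OF bipartition_in_partitions[OF that]]
    by (simp add: lookup_toric_monomial_bipartition[OF pair_edges_if_simple_graph[OF sg] that])
  obtain z where z: "K = S_var \<and> z = 2 * mult G e \<or> K = T_var \<and> z = - 2 * mult G e"
    using K by blast
  have z0: "z \<noteq> 0" using z m by auto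
  have "0 = (\<Sum>s<length as. d s * of_int (expo G {x} (K (as ! s)))) +
      (\<Sum>s<length as. d s * of_int (expo G {y} (K (as ! s)))) -
      (\<Sum>s<length as. d s * of_int (expo G {x, y} (K (as ! s)))) -
      (\<Sum>s<length as. d s * of_int (expo G {} (K (as ! s))))"
    using xy by (simp add: ex0)
  also have "\<dots> = (\<Sum>s<length as. d s * of_int (expo G {x} (K (as ! s)) + expo G {y} (K (as ! s))
      - expo G {x, y} (K (as ! s)) - expo G {} (K (as ! s))))"
    by (simp add: sum.distrib sum_subtractf algebra_simps)
  also have "\<dots> = (\<Sum>s<length as. if as ! s = as ! t then d s * of_int z else 0)"
    unfolding expo_isolates_edge[OF sg e(1) xy(3) z] by (intro sum.cong) (auto simp: e(2))
  also have "\<dots> = d t * of_int z"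
    using as t by (intro sum_nth_delta) (auto simp: enumerates_def)
  finally show ?thesis using z0 by simp
qed

text \<open>The block form keeps \<open>s\<close>-rows and \<open>t\<close>-rows apart. A row of
  \<open>X - X'\<close> is a linear relation among the \<open>s\<close>-rows alone, a row of
  \<open>Y - Y'\<close> one among the \<open>t\<close>-rows alone, and both must vanish.\<close>

lemma block_factor_unique:
  fixes M N :: "'c::{idom,ring_char_0} mat"
  assumes G: "labelled_graph G" and as: "enumerates as (labels G)"
    and ps: "enumerates ps (partitions (verts G))"
    and M: "has_block_form r (length as) M" and N: "has_block_form r (length as) N"
    and eq: "M * map_mat of_int (toric_mat G as ps) = N * map_mat of_int (toric_mat G as ps)"
  shows "M = N"
proof -
  let ?T = "map_mat of_int (toric_mat G as ps) :: 'c mat" and ?k = "length as"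
  obtain X Y where X: "X \<in> carrier_mat r ?k" and Y: "Y \<in> carrier_mat r ?k"
    and MXY: "M = block_diag X Y" using M unfolding has_block_form_def by blast
  obtain X' Y' where X': "X' \<in> carrier_mat r ?k" and Y': "Y' \<in> carrier_mat r ?k"
    and NXY: "N = block_diag X' Y'" using N unfolding has_block_form_def by blast
  have T: "?T \<in> carrier_mat (2 * ?k) (length ps)" using toric_mat_carrier by auto
  have dims: "dim_row (toric_mat G as ps) = 2 * ?k" "dim_col (toric_mat G as ps) = length ps"
    using toric_mat_carrier[of G as ps] by auto
  have XX: "X $$ (i, t) = X' $$ (i, t)" if i: "i < r" and t: "t < ?k" for i t
  proof -
    have "X $$ (i, t) - X' $$ (i, t) = 0"
    proof (rule toric_rows_independent[OF G as _ _ t, of S_var])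
      fix p assume "p \<in> partitions (verts G)"
      then obtain j where j: "j < length ps" "ps ! j = p"
        using ps unfolding enumerates_def by (metis in_set_conv_nth)
      show "(\<Sum>t<?k. (X $$ (i, t) - X' $$ (i, t)) *
          of_int (Poly_Mapping.lookup (toric_monomial G p) (S_var (as ! t)))) = 0"
        using index_block_diag_mult(1)[OF X Y T i j(1)] index_block_diag_mult(1)[OF X' Y' T i j(1)]
          eq j by (simp add: MXY NXY index_toric_mat dims left_diff_distrib sum_subtractf)
    qed simp
    then show ?thesis by simp
  qed
  have YY: "Y $$ (i, t) = Y' $$ (i, t)" if i: "i < r" and t: "t < ?k" for i t
  proof -
    have "Y $$ (i, t) - Y' $$ (i, t) = 0"
    proof (rule toric_rows_independent[OF G as _ _ t, of T_var])
      fix p assume "p \<in> partitions (verts G)"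
      then obtain j where j: "j < length ps" "ps ! j = p"
        using ps unfolding enumerates_def by (metis in_set_conv_nth)
      show "(\<Sum>t<?k. (Y $$ (i, t) - Y' $$ (i, t)) *
          of_int (Poly_Mapping.lookup (toric_monomial G p) (T_var (as ! t)))) = 0"
        using index_block_diag_mult(2)[OF X Y T i j(1)] index_block_diag_mult(2)[OF X' Y' T i j(1)]
          eq j by (simp add: MXY NXY index_toric_mat dims left_diff_distrib sum_subtractf)
    qed simp
    then show ?thesis by simp
  qed
  have "X = X'" by (rule eq_matI) (use X X' XX in auto)
  moreover have "Y = Y'" by (rule eq_matI) (use Y Y' YY in auto)
  ultimately show ?thesis by (simp add: MXY NXY)
qed

lemma block_form_map_of_int:
  assumes "B \<in> carrier_mat r c"
  shows "has_block_form r c (map_mat of_int (block_diag B B) :: 'c::ring_1 mat)"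
proof -
  have "map_mat of_int (block_diag B B) =
      (block_diag (map_mat of_int B) (map_mat of_int B) :: 'c mat)"
    by (rule eq_matI) (auto simp: block_diag_def)
  moreover have "map_mat of_int B \<in> carrier_mat r c" using assms by simp
  ultimately show ?thesis unfolding has_block_form_def by blast
qed

text \<open>The integer factorization carries over to the ring along the homomorphism
  \<open>of_int\<close>, where uniqueness identifies any other block factor with it.\<close>

lemma block_factor_eq_map_of_int:
  fixes M :: "'c::{idom,ring_char_0} mat"
  assumes G: "labelled_graph G" and as: "enumerates as (labels G)"
    and ps: "enumerates ps (partitions (verts G))"
    and B: "B \<in> carrier_mat r (length as)" and N: "N = block_diag B B * toric_mat G as ps"
    and M: "has_block_form r (length as) M"
    and eq: "map_mat of_int N = M * map_mat of_int (toric_mat G as ps)"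
  shows "M = map_mat of_int (block_diag B B)"
proof (rule block_factor_unique[OF G as ps M block_form_map_of_int[OF B]])
  show "M * map_mat of_int (toric_mat G as ps) =
      map_mat of_int (block_diag B B) * map_mat of_int (toric_mat G as ps)"
    using eq of_int_hom.mat_hom_mult[OF block_diag_carrier[OF B B] toric_mat_carrier[of G as ps]]
    unfolding N by metis
qed

section \<open>Renaming vertices\<close>

text \<open>The base point is renamed along with the vertices, so sides avoiding \<open>u\<close>
  correspond to sides avoiding its image, and corresponding columns agree entry by entry in the
  matched edge order.\<close>

lemma mset_cols_rename:
  assumes VE: "simple_graph V E" and inj: "inj_on \<pi> V" and es: "enumerates es E"
    and ps: "enumerates ps (partitions V)" and ps': "enumerates ps' (partitions (\<pi> ` V))"
  shows "mset (cols (toric_mat (classical (\<pi> ` V) ((`) \<pi> ` E)) (map ((`) \<pi>) es) ps')) =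
    mset (cols (toric_mat (classical V E) es ps))"
proof -
  let ?G = "classical V E" and ?H = "classical (\<pi> ` V) ((`) \<pi> ` E)"
  have G: "pair_edges ?G"
    by (rule pair_edges_if_simple_graph) (use VE in \<open>simp add: classical_def\<close>)
  have E: "e \<subseteq> V" if "e \<in> E" for e
    using pair_edges_subset[OF G] that by (simp add: classical_def)
  have H: "pair_edges ?H"
    using pair_edges_map_verts[OF G, of \<pi>]
    by (simp add: pair_edges_def classical_def map_verts_def)
  obtain u where u: "u \<in> V" using VE unfolding simple_graph_def by auto
  \<comment> \<open>Columns are compared as vectors here, since the two graphs have different row
    variables.\<close>
  have mc: "mset (cols (toric_mat K xs rs)) =
      (\<Sum>A\<in>Pow (verts K - {w}). {#vec_of_list (map (expo K A) (row_vars xs))#})"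
    if "pair_edges K" "w \<in> verts K" "enumerates rs (partitions (verts K))"
    for K :: "('v, 'v set) lgraph" and xs rs w
  proof -
    have "mset (cols (toric_mat K xs rs)) =
        image_mset (\<lambda>\<phi>. vec_of_list (map \<phi> (row_vars xs))) (\<Sum>A\<in>Pow (verts K - {w}). {#expo K A#})"
      using mset_toric_columns[OF that, symmetric]
      by (simp add: toric_mat_eq_mat_of_funs cols_mat_of_funs image_mset.compositionality comp_def)
    also have "\<dots> = (\<Sum>A\<in>Pow (verts K - {w}). {#vec_of_list (map (expo K A) (row_vars xs))#})"
      by (subst sum_comp_morphism[of "image_mset _", symmetric]) (auto simp: comp_def)
    finally show ?thesis .
  qed
  have bij: "bij_betw ((`) \<pi>) (Pow (V - {u})) (Pow (\<pi> ` V - {\<pi> u}))"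
  proof -
    have "\<pi> ` (V - {u}) = \<pi> ` V - {\<pi> u}"
      using inj u by (simp add: inj_on_image_set_diff[of \<pi> V])
    then have "bij_betw \<pi> (V - {u}) (\<pi> ` V - {\<pi> u})"
      using inj by (metis Diff_subset bij_betw_imageI inj_on_subset)
    then show ?thesis by (rule bij_betw_Pow)
  qed
  have inj_img: "\<pi> ` d = \<pi> ` e \<longleftrightarrow> d = e" if "d \<in> E" "e \<in> E" for d e
    using inj_on_image_eq_iff[OF inj] E that by blast
  have inj_E: "inj_on ((`) \<pi>) E" using inj_img by (simp add: inj_on_def)
  \<comment> \<open>\<open>\<pi>\<close> is injective only on \<open>V\<close>, so distinct
    variables are sure to stay distinct only for labels that are edges; hence the restriction on
    \<open>z\<close>.\<close>
  have ex: "expo ?H (\<pi> ` A) (map_tvar ((`) \<pi>) z) = expo ?G A z"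
    if A: "A \<subseteq> V" and z: "z \<in> set (row_vars es)" for A z
  proof -
    have cr: "crosses (\<pi> ` A) (\<pi> ` e) = crosses A e" if "e \<in> E" for e
      using inj A E[OF that] unfolding crosses_def inj_on_def by blast
    have "expo ?H (\<pi> ` A) (map_tvar ((`) \<pi>) z) =
      (\<Sum>e\<in>E. if map_tvar ((`) \<pi>) z = (if crosses (\<pi> ` A) (\<pi> ` e) then S_var (\<pi> ` e) else T_var (\<pi> ` e))
        then 1 else 0)"
      by (simp add: expo_def classical_def sum.reindex[OF inj_E] cong: if_cong)
    also have "\<dots> = expo ?G A z"
      using z es cr inj_img
      by (auto simp: expo_def classical_def row_vars_def enumerates_def cong: if_cong intro!: sum.cong)
    finally show ?thesis .
  qed
  have rv: "row_vars (map ((`) \<pi>) es) = map (map_tvar ((`) \<pi>)) (row_vars es)"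
    by (simp add: row_vars_def)
  have "mset (cols (toric_mat ?H (map ((`) \<pi>) es) ps')) = (\<Sum>B\<in>Pow (\<pi> ` V - {\<pi> u}).
      {#vec_of_list (map (expo ?H B) (row_vars (map ((`) \<pi>) es)))#})"
    using mc[OF H, of "\<pi> u" ps'] u ps' by (simp add: classical_def)
  also have "\<dots> = (\<Sum>A\<in>Pow (V - {u}).
      {#vec_of_list (map (expo ?H (\<pi> ` A)) (row_vars (map ((`) \<pi>) es)))#})"
    by (rule sum.reindex_bij_betw[OF bij, symmetric])
  also have "\<dots> = (\<Sum>A\<in>Pow (V - {u}). {#vec_of_list (map (expo ?G A) (row_vars es))#})"
  proof (rule sum.cong[OF refl])
    fix A assume "A \<in> Pow (V - {u})"
    then have "A \<subseteq> V" by blast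
    then have "map (expo ?H (\<pi> ` A)) (row_vars (map ((`) \<pi>) es)) = map (expo ?G A) (row_vars es)"
      unfolding rv using ex by simp
    then show "{#vec_of_list (map (expo ?H (\<pi> ` A)) (row_vars (map ((`) \<pi>) es)))#} =
        {#vec_of_list (map (expo ?G A) (row_vars es))#}" by simp
  qed
  also have "\<dots> = mset (cols (toric_mat ?G es ps))"
    using mc[OF G, of u ps] u ps by (simp add: classical_def)
  finally show ?thesis .
qed

lemma toric_mat_rename:
  assumes VE: "simple_graph V E" and inj: "inj_on \<pi> V" and es: "enumerates es E"
    and ps: "enumerates ps (partitions V)" and ps': "enumerates ps' (partitions (\<pi> ` V))"
  shows "length ps' = length ps \<and> (\<exists>g. g permutes {..<length ps} \<and>
    toric_mat (classical (\<pi> ` V) ((`) \<pi> ` E)) (map ((`) \<pi>) es) ps' =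
    mat (2 * length es) (length ps) (\<lambda>(i, j). toric_mat (classical V E) es ps $$ (i, g j)))"
proof -
  let ?M = "toric_mat (classical V E) es ps"
  let ?N = "toric_mat (classical (\<pi> ` V) ((`) \<pi> ` E)) (map ((`) \<pi>) es) ps'"
  note eq = mset_cols_rename[OF assms]
  have dims: "dim_row ?M = 2 * length es" "dim_col ?M = length ps"
    "dim_row ?N = 2 * length es" "dim_col ?N = length ps'"
    by (simp_all add: toric_mat_def)
  have len: "length ps' = length ps" using mset_eq_length[OF eq] by (simp add: dims)
  obtain g where g: "g permutes {..<length (cols ?N)}"
      "\<And>j. j < length (cols ?N) \<Longrightarrow> cols ?N ! j = cols ?M ! g j"
    using nth_permutation_if_mset_eq[OF eq] by blast
  have g': "g permutes {..<length ps}" using g(1) by (simp add: dims len)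
  have "?N = mat (2 * length es) (length ps) (\<lambda>(i, j). ?M $$ (i, g j))"
  proof (rule eq_matI)
    fix i j assume "i < dim_row (mat (2 * length es) (length ps) (\<lambda>(i, j). ?M $$ (i, g j)))"
      and "j < dim_col (mat (2 * length es) (length ps) (\<lambda>(i, j). ?M $$ (i, g j)))"
    then have i: "i < 2 * length es" and j: "j < length ps" by auto
    have gj: "g j < length ps" using permutes_in_image[OF g', of j] j by simp
    have "col ?N j = col ?M (g j)" using g(2)[of j] j gj by (simp add: dims len)
    then have "col ?N j $ i = col ?M (g j) $ i" by simp
    then show "?N $$ (i, j) = mat (2 * length es) (length ps) (\<lambda>(i, j). ?M $$ (i, g j)) $$ (i, j)"
      using i j gj by (simp add: dims len)
  qed (simp_all add: dims len)
  then show ?thesis using len g' by blast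
qed

section \<open>Assembly of the six claims\<close>

theorem lemma3p1:
  fixes V :: "'v set" and E :: "'v set set" and \<sigma> :: "'v set \<Rightarrow> int"
    and l :: "'v set \<Rightarrow> 'a" and A :: "'a set"
    and G :: "('v, 'a) lgraph" and H :: "('w, 'b) lgraph"
    and es :: "'v set list" and as :: "'a list" and ps :: "'v set set list"
    and bs :: "'b list" and qs :: "'w set set list"
  assumes "simple_graph V E" and "is_multiplicity E \<sigma>" and "is_labeling E l A"
    and "enumerates es E" and "enumerates as A" and "enumerates ps (partitions V)"
    and "G = \<lparr>verts = V, edges = E, lab = l, labels = A, mult = \<sigma>\<rparr>"
    and "labelled_graph H"
    and "enumerates bs (labels H)" and "enumerates qs (partitions (verts H))"
  shows
    \<comment> \<open>i)\<close>
    "(\<forall>\<pi> :: 'v \<Rightarrow> 'v. \<forall>ps'. inj_on \<pi> V \<and> enumerates ps' (partitions (\<pi> ` V)) \<longrightarrow>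
        length ps' = length ps \<and>
        (\<exists>g. g permutes {..<length ps} \<and>
           toric_mat (classical (\<pi> ` V) ((`) \<pi> ` E)) (map ((`) \<pi>) es) ps' =
           mat (2 * length es) (length ps) (\<lambda>(i, j). toric_mat (classical V E) es ps $$ (i, g j))))
   \<and> \<comment> \<open>ii)\<close>
     (let m = length es;
          I\<^sub>\<sigma> = mat_diag m (\<lambda>i. \<sigma> (es ! i));
          M\<^sub>\<sigma> = block_diag I\<^sub>\<sigma> I\<^sub>\<sigma>
      in toric_mat (with_mult V E \<sigma>) es ps = M\<^sub>\<sigma> * toric_mat (classical V E) es ps \<and>
         (\<forall>M :: 'c::{idom,ring_char_0} mat. has_block_form m m M \<and>
            map_mat of_int (toric_mat (with_mult V E \<sigma>) es ps) =
              M * map_mat of_int (toric_mat (classical V E) es ps)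
            \<longrightarrow> M = map_mat of_int M\<^sub>\<sigma>))
   \<and> \<comment> \<open>iii)\<close>
     (let m = length es; k = length as;
          B\<^sub>l = mat k m (\<lambda>(i, j). if as ! i = l (es ! j) then 1 else 0);
          R\<^sub>l = block_diag B\<^sub>l B\<^sub>l
      in toric_mat (with_lab V E l A) as ps = R\<^sub>l * toric_mat (classical V E) es ps \<and>
         (\<forall>R :: 'c mat. has_block_form k m R \<and>
            map_mat of_int (toric_mat (with_lab V E l A) as ps) =
              R * map_mat of_int (toric_mat (classical V E) es ps)
            \<longrightarrow> R = map_mat of_int R\<^sub>l))
   \<and> \<comment> \<open>iii.bis)\<close>
     (\<forall>cs a\<^sub>k c. as = cs @ [a\<^sub>k] \<and> c \<in> A - {a\<^sub>k} \<longrightarrow>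
       (let k = length as; k' = length cs;
            r = (\<lambda>a. if a = a\<^sub>k then c else a);
            G' = \<lparr>verts = V, edges = E, lab = (\<lambda>e. r (l e)), labels = A - {a\<^sub>k}, mult = \<sigma>\<rparr>;
            B' = mat k' k (\<lambda>(i, j). if cs ! i = r (as ! j) then 1 else 0);
            R' = block_diag B' B'
        in toric_mat G' cs ps = R' * toric_mat G as ps \<and>
           (\<forall>R :: 'c mat. has_block_form k' k R \<and>
              map_mat of_int (toric_mat G' cs ps) = R * map_mat of_int (toric_mat G as ps)
              \<longrightarrow> R = map_mat of_int R')))
   \<and> \<comment> \<open>iv)\<close>
     (\<forall>ds rs. enumerates ds (labels (disj_union G H)) \<and>
              enumerates rs (partitions (verts (disj_union G H))) \<longrightarrow>
        eq_up_to_order (row_vars ds) (toric_mat (disj_union G H) ds rs)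
          (hash_row_vars as bs)
          (repeat_cols_twice (hash_mat (toric_mat G as ps) (toric_mat H bs qs))))
   \<and> \<comment> \<open>v)\<close>
     (\<forall>u v ds rs. u \<in> V \<and> v \<in> verts H \<and>
              enumerates ds (labels (zero_sum u v G H)) \<and>
              enumerates rs (partitions (verts (zero_sum u v G H))) \<longrightarrow>
        eq_up_to_order (row_vars ds) (toric_mat (zero_sum u v G H) ds rs)
          (hash_row_vars as bs)
          (hash_mat (toric_mat G as ps) (toric_mat H bs qs)))"
proof -
  have fin: "finite E"
    using pair_edges_finite[OF pair_edges_if_simple_graph, of G] assms(1,7) by simp
  have lA: "l ` E = A" using assms(3) by (simp add: is_labeling_def)
  have GL: "labelled_graph G" using assms(1,2,3,7) by (simp add: labelled_graph_def)
  have CL: "labelled_graph (classical V E)"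
    using assms(1) by (simp add: labelled_graph_def classical_def is_labeling_def is_multiplicity_def)
  have as: "enumerates as (labels G)" and ps: "enumerates ps (partitions (verts G))"
    using assms(5,6,7) by simp_all
  have Ces: "enumerates es (labels (classical V E))"
    and Cps: "enumerates ps (partitions (verts (classical V E)))"
    using assms(4,6) by (simp_all add: classical_def)
  have G: "pair_edges G" by (rule pair_edges_if_simple_graph) (use assms(1,7) in simp)
  have H: "simple_graph (verts H) (edges H)" using assms(8) by (simp add: labelled_graph_def)
  \<comment> \<open>Vertex sets are nonempty; these arbitrary base points serve the disjoint union
    in iv).\<close>
  obtain u\<^sub>0 where u\<^sub>0: "u\<^sub>0 \<in> verts G" using assms(1,7) unfolding simple_graph_def by auto
  obtain v\<^sub>0 where v\<^sub>0: "v\<^sub>0 \<in> verts H" using H unfolding simple_graph_def by auto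
  show ?thesis
  proof (intro conjI, goal_cases)
    case 1
    then show ?case using toric_mat_rename[OF assms(1) _ assms(4,6)] by blast
  next
    case 2
    let ?B = "mat_diag (length es) (\<lambda>i. \<sigma> (es ! i))"
    have f: "toric_mat (with_mult V E \<sigma>) es ps = block_diag ?B ?B * toric_mat (classical V E) es ps"
      by (rule toric_mat_with_mult[OF fin assms(4) refl])
    show ?case unfolding Let_def
      by (intro conjI allI impI f, elim conjE)
         (rule block_factor_eq_map_of_int[OF CL Ces Cps _ f], auto)
  next
    case 3
    let ?B = "mat (length as) (length es) (\<lambda>(i, j). if as ! i = l (es ! j) then 1 else 0)"
    \<comment> \<open>The canonical labels are the edges themselves, so the relabelling map is
      \<open>l\<close>.\<close>
    have f: "toric_mat (with_lab V E l A) as ps = block_diag ?B ?B * toric_mat (classical V E) es ps"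
      by (rule toric_mat_relabel[OF _ Ces]) (use fin in \<open>simp_all add: classical_def with_lab_def\<close>)
    show ?case unfolding Let_def
      by (intro conjI allI impI f, elim conjE)
         (rule block_factor_eq_map_of_int[OF CL Ces Cps _ f], auto)
  next
    case 4
    show ?case
    proof (intro allI impI)
      fix cs :: "'a list" and a\<^sub>k c :: 'a
      let ?r = "\<lambda>a. if a = a\<^sub>k then c else a"
      let ?B = "mat (length cs) (length as) (\<lambda>(i, j). if cs ! i = ?r (as ! j) then 1 else 0)"
      let ?G = "\<lparr>verts = V, edges = E, lab = (\<lambda>e. ?r (l e)), labels = A - {a\<^sub>k}, mult = \<sigma>\<rparr>"
      have f: "toric_mat ?G cs ps = block_diag ?B ?B * toric_mat G as ps"
        by (rule toric_mat_relabel[OF _ as, where r = ?r]) (use fin lA assms(7) in \<open>simp_all cong: if_cong\<close>)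
      show "let k = length as; k' = length cs; r = ?r;
            G' = \<lparr>verts = V, edges = E, lab = (\<lambda>e. r (l e)), labels = A - {a\<^sub>k}, mult = \<sigma>\<rparr>;
            B' = mat k' k (\<lambda>(i, j). if cs ! i = r (as ! j) then 1 else 0);
            R' = block_diag B' B'
        in toric_mat G' cs ps = R' * toric_mat G as ps \<and>
           (\<forall>R :: 'c mat. has_block_form k' k R \<and>
              map_mat of_int (toric_mat G' cs ps) = R * map_mat of_int (toric_mat G as ps)
              \<longrightarrow> R = map_mat of_int R')"
        unfolding Let_def
        by (intro conjI allI impI f, elim conjE)
           (rule block_factor_eq_map_of_int[OF GL as ps _ f], auto)
    qed
  next
    case 5
    show ?case
      using toric_mat_disj_union[OF G u\<^sub>0 pair_edges_if_simple_graph[OF H] v\<^sub>0 as ps assms(9,10)]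
      by blast
  next
    case 6
    \<comment> \<open>In v) the base points are the two vertices being identified.\<close>
    show ?case
      using toric_mat_zero_sum[OF G _ H _ as ps assms(9,10)] assms(7) by auto
  qed
qed

end
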